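(* (Confluence, for untyped terms.) For all terms $t_1,t_2,t_3$: if $t_1\twoheadrightarrow t_2$ and $t_1\twoheadrightarrow t_3$, then there exists a term $t_4$ such that $t_2\twoheadrightarrow t_4$ and $t_3\twoheadrightarrow t_4$.
   Context: Calculus $\lambda^{::}_{\mathtt{catch}}$ (untyped terms). Terms: $t,r,s ::= x \mid () \mid \mathtt{nil} \mid (::) \mid \mathtt{lrec} \mid \lambda x.r \mid t\,s \mid \mathtt{catch}\,\alpha\,t \mid \mathtt{throw}\,\alpha\,t$ ($x$ variables, $\alpha,\beta$ continuation variables; $\lambda x$ binds $x$, $\mathtt{catch}\,\alpha$ binds $\alpha$; terms modulo renaming of bound variables; application left-associative; $t::r$ abbreviates $(::)\,t\,r$). $\mathrm{FCV}$ = free continuation variables, $t[x:=r]$ capture-avoiding substitution. Values: $v,w ::= x \mid () \mid \mathtt{nil} \mid (::) \mid (::)\,v \mid (::)\,v\,w \mid \mathtt{lrec} \mid \mathtt{lrec}\,v \mid \mathtt{lrec}\,v\,w \mid \lambda x.r$. Contexts $E ::= \Box\,t \mid v\,\Box \mid \mathtt{throw}\,\alpha\,\Box$. One-step reduction $\to$ is the compatible closure (closure under all term constructors) of: $(\lambda x.t)\,v\to t[x:=v]$; $E[\mathtt{throw}\,\alpha\,t]\to\mathtt{throw}\,\alpha\,t$; $\mathtt{catch}\,\alpha\,(\mathtt{throw}\,\alpha\,t)\to\mathtt{catch}\,\alpha\,t$; $\mathtt{catch}\,\alpha\,(\mathtt{throw}\,\beta\,v)\to\mathtt{throw}\,\beta\,v$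 if $\alpha\notin\{\beta\}\cup\mathrm{FCV}(v)$; $\mathtt{catch}\,\alpha\,v\to v$ if $\alpha\notin\mathrm{FCV}(v)$; $\mathtt{lrec}\,v_r\,v_s\,\mathtt{nil}\to v_r$; $\mathtt{lrec}\,v_r\,v_s\,(v_h::v_t)\to v_s\,v_h\,v_t\,(\mathtt{lrec}\,v_r\,v_s\,v_t)$. $\twoheadrightarrow$ is the reflexive-transitive closure of $\to$. *)

theory Defs
  imports Main
begin

text \<open>
  Terms modulo renaming of bound variables are represented with de Bruijn indices. There are two
  independent index spaces: indices of ordinary variables (bound by
  \<open>Lam\<close>) and of continuation variables (bound by \<open>Catch\<close>). Dangling indices are the
  free variables. \<open>ConsC\<close> is the constant \<open>(::)\<close>, so \<open>t :: r\<close> is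
  \<open>App (App ConsC t) r\<close>.
\<close>

datatype trm =
    Var nat
  | UnitC
  | NilC
  | ConsC
  | LRec
  | Lam trm
  | App trm trm
  | Catch trm
  | Throw nat trm

primrec FCV :: "trm \<Rightarrow> nat set" where
  "FCV (Var i) = {}"
| "FCV UnitC = {}"
| "FCV NilC = {}"
| "FCV ConsC = {}"
| "FCV LRec = {}"
| "FCV (Lam t) = FCV t"
| "FCV (App t s) = FCV t \<union> FCV s"
| "FCV (Catch t) = {a. Suc a \<in> FCV t}"
| "FCV (Throw a t) = insert a (FCV t)"

text \<open>
  \<open>lift k\<close> and \<open>clift k\<close> insert an unused ordinary, respectively continuation,
  index \<open>k\<close>; \<open>clower k\<close> removes the continuation index \<open>k\<close> and is only
  meaningful if \<open>k\<close> is not free in the term.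
\<close>

primrec lift :: "nat \<Rightarrow> trm \<Rightarrow> trm" where
  "lift k (Var i) = Var (if i < k then i else Suc i)"
| "lift k UnitC = UnitC"
| "lift k NilC = NilC"
| "lift k ConsC = ConsC"
| "lift k LRec = LRec"
| "lift k (Lam t) = Lam (lift (Suc k) t)"
| "lift k (App t s) = App (lift k t) (lift k s)"
| "lift k (Catch t) = Catch (lift k t)"
| "lift k (Throw a t) = Throw a (lift k t)"

primrec clift :: "nat \<Rightarrow> trm \<Rightarrow> trm" where
  "clift k (Var i) = Var i"
| "clift k UnitC = UnitC"
| "clift k NilC = NilC"
| "clift k ConsC = ConsC"
| "clift k LRec = LRec"
| "clift k (Lam t) = Lam (clift k t)"
| "clift k (App t s) = App (clift k t) (clift k s)"
| "clift k (Catch t) = Catch (clift (Suc k) t)"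
| "clift k (Throw a t) = Throw (if a < k then a else Suc a) (clift k t)"

primrec clower :: "nat \<Rightarrow> trm \<Rightarrow> trm" where
  "clower k (Var i) = Var i"
| "clower k UnitC = UnitC"
| "clower k NilC = NilC"
| "clower k ConsC = ConsC"
| "clower k LRec = LRec"
| "clower k (Lam t) = Lam (clower k t)"
| "clower k (App t s) = App (clower k t) (clower k s)"
| "clower k (Catch t) = Catch (clower (Suc k) t)"
| "clower k (Throw a t) = Throw (if a \<le> k then a else a - 1) (clower k t)"

lemma clower_clift: "clower k (clift k t) = t"
  by (induction t arbitrary: k) auto

lemma clift_clower: "k \<notin> FCV t \<Longrightarrow> clift k (clower k t) = t"
  by (induction t arbitrary: k) auto

lemma not_in_FCV_clift: "k \<notin> FCV (clift k t)"
  by (induction t arbitrary: k) auto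

text \<open>
  \<open>subst t k r\<close> is the capture-avoiding substitution of \<open>r\<close> for the variable
  with index \<open>k\<close>, where the binder of that variable is removed at the same time.
\<close>

primrec subst :: "trm \<Rightarrow> nat \<Rightarrow> trm \<Rightarrow> trm" where
  "subst (Var i) k r = (if i < k then Var i else if i = k then r else Var (i - 1))"
| "subst UnitC k r = UnitC"
| "subst NilC k r = NilC"
| "subst ConsC k r = ConsC"
| "subst LRec k r = LRec"
| "subst (Lam t) k r = Lam (subst t (Suc k) (lift 0 r))"
| "subst (App t s) k r = App (subst t k r) (subst s k r)"
| "subst (Catch t) k r = Catch (subst t k (clift 0 r))"
| "subst (Throw a t) k r = Throw a (subst t k r)"

inductive val :: "trm \<Rightarrow> bool" where
  "val (Var i)"
| "val UnitC"
| "val NilC"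
| "val ConsC"
| "val v \<Longrightarrow> val (App ConsC v)"
| "val v \<Longrightarrow> val w \<Longrightarrow> val (App (App ConsC v) w)"
| "val LRec"
| "val v \<Longrightarrow> val (App LRec v)"
| "val v \<Longrightarrow> val w \<Longrightarrow> val (App (App LRec v) w)"
| "val (Lam r)"

datatype ctx = CtxL trm | CtxR trm | CtxThrow nat

primrec wf_ctx :: "ctx \<Rightarrow> bool" where
  "wf_ctx (CtxL t) = True"
| "wf_ctx (CtxR v) = val v"
| "wf_ctx (CtxThrow a) = True"

primrec fill :: "ctx \<Rightarrow> trm \<Rightarrow> trm" where
  "fill (CtxL t) s = App s t"
| "fill (CtxR v) s = App v s"
| "fill (CtxThrow a) s = Throw a s"

text \<open>
  In \<open>catch_throw_other\<close> and \<open>catch_val\<close> the catch binder (continuation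
  index 0) disappears, so the remaining continuation indices are lowered by one.
\<close>

inductive contract :: "trm \<Rightarrow> trm \<Rightarrow> bool" where
  beta: "val v \<Longrightarrow> contract (App (Lam t) v) (subst t 0 v)"
| ctx_throw: "wf_ctx E \<Longrightarrow> contract (fill E (Throw a t)) (Throw a t)"
| catch_throw_same: "contract (Catch (Throw 0 t)) (Catch t)"
| catch_throw_other: "val v \<Longrightarrow> 0 \<notin> {b} \<union> FCV v \<Longrightarrow>
    contract (Catch (Throw b v)) (clower 0 (Throw b v))"
| catch_val: "val v \<Longrightarrow> 0 \<notin> FCV v \<Longrightarrow> contract (Catch v) (clower 0 v)"
| lrec_nil: "val vr \<Longrightarrow> val vs \<Longrightarrow> contract (App (App (App LRec vr) vs) NilC) vr"
| lrec_cons: "val vr \<Longrightarrow> val vs \<Longrightarrow> val vh \<Longrightarrow> val vt \<Longrightarrow>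
    contract (App (App (App LRec vr) vs) (App (App ConsC vh) vt))
      (App (App (App vs vh) vt) (App (App (App LRec vr) vs) vt))"

inductive step :: "trm \<Rightarrow> trm \<Rightarrow> bool" where
  step_contract: "contract t t' \<Longrightarrow> step t t'"
| step_Lam: "step t t' \<Longrightarrow> step (Lam t) (Lam t')"
| step_AppL: "step t t' \<Longrightarrow> step (App t s) (App t' s)"
| step_AppR: "step s s' \<Longrightarrow> step (App t s) (App t s')"
| step_Catch: "step t t' \<Longrightarrow> step (Catch t) (Catch t')"
| step_Throw: "step t t' \<Longrightarrow> step (Throw a t) (Throw a t')"

abbreviation steps :: "trm \<Rightarrow> trm \<Rightarrow> bool" where
  "steps \<equiv> step\<^sup>*\<^sup>*"

end

theory Submission
  imports Defs
begin

text \<open>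
  Tait--Martin-Loef parallel reduction in Takahashi's style: \<open>par\<close> lies between \<open>step\<close> and
  \<open>steps\<close>, and every term \<open>t\<close> has a complete development, that is a term to which each
  parallel reduct of \<open>t\<close> reduces in one parallel step; hence \<open>par\<close> has the diamond property.
  The redexes overlap only harmlessly, because no throw is a value and values are closed under
  reduction and under substitution of values.
\<close>

section \<open>Commutation of liftings and substitution\<close>

lemma lift_lift: "i \<le> k \<Longrightarrow> lift i (lift k t) = lift (Suc k) (lift i t)"
  by (induction t arbitrary: i k) auto

lemma clift_clift: "i \<le> k \<Longrightarrow> clift i (clift k t) = clift (Suc k) (clift i t)"
  by (induction t arbitrary: i k) auto

lemma lift_clift: "lift i (clift k t) = clift k (lift i t)"
  by (induction t arbitrary: i k) auto

lemma clift_subst: "clift k (subst t i r) = subst (clift k t) i (clift k r)"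
  by (induction t arbitrary: k i r) (auto simp: lift_clift clift_clift)

lemma lift_subst_le: "i \<le> k \<Longrightarrow> lift i (subst t k r) = subst (lift i t) (Suc k) (lift i r)"
  by (induction t arbitrary: k i r) (auto simp: lift_clift lift_lift)

lemma lift_subst_ge: "i \<le> k \<Longrightarrow> lift k (subst t i r) = subst (lift (Suc k) t) i (lift k r)"
  by (induction t arbitrary: k i r) (auto simp: lift_clift lift_lift)

lemma subst_lift [simp]: "subst (lift k t) k r = t"
  by (induction t arbitrary: k r) auto

text \<open>The substitution lemma in de Bruijn form. Since \<open>subst\<close> also removes a
  binder, the outer index \<open>k\<close> reads \<open>Suc k\<close> while index \<open>i\<close>
  is still present, and \<open>u\<close> has to be lifted past \<open>i\<close>.\<close>

lemma subst_subst:
  "i \<le> k \<Longrightarrow> subst (subst t i v) k u = subst (subst t (Suc k) (lift i u)) i (subst v k u)"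
  by (induction t arbitrary: i k v u)
    (auto simp: lift_clift lift_lift lift_subst_le clift_subst)

section \<open>Preimages under continuation lifting\<close>

lemma clift_inject [simp]: "clift k t = clift k s \<longleftrightarrow> t = s"
  by (metis clower_clift)

text \<open>\<open>clift\<close> preserves the head constructor, so redex patterns can be pulled
  back through it. As simp rules these equivalences let inversion on a lifted term decompose the
  original term.\<close>

lemma clift_eq_iff [simp]:
  "clift k t = Var i \<longleftrightarrow> t = Var i"
  "clift k t = UnitC \<longleftrightarrow> t = UnitC"
  "clift k t = NilC \<longleftrightarrow> t = NilC"
  "clift k t = ConsC \<longleftrightarrow> t = ConsC"
  "clift k t = LRec \<longleftrightarrow> t = LRec"
  "clift k t = Lam s \<longleftrightarrow> (\<exists>t'. t = Lam t' \<and> s = clift k t')"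
  "clift k t = App s r \<longleftrightarrow> (\<exists>s' r'. t = App s' r' \<and> s = clift k s' \<and> r = clift k r')"
  "clift k t = Catch s \<longleftrightarrow> (\<exists>t'. t = Catch t' \<and> s = clift (Suc k) t')"
  "clift k t = Throw a s \<longleftrightarrow>
     (\<exists>b t'. t = Throw b t' \<and> a = (if b < k then b else Suc b) \<and> s = clift k t')"
  by (cases t; auto)+

lemmas eq_clift_iff [simp] = clift_eq_iff[THEN trans[OF eq_commute]]

text \<open>A term that is lifted both at \<open>i\<close> and at \<open>Suc k\<close> misses both
  indices, hence comes from one term \<open>p\<close> by lifting twice; this is a converse of
  \<open>clift_clift\<close>. It serves a catch, whose own index 0 and an outer index are both
  absent from the body.\<close>

lemma clift_eq_cliftD:
  "i \<le> k \<Longrightarrow> clift i t = clift (Suc k) s \<Longrightarrow> \<exists>p. t = clift k p \<and> s = clift i p"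
proof (induction t arbitrary: i k s)
  case (Lam t)
  then show ?case by (cases s) (auto, metis clift.simps(6))
next
  case (App t1 t2)
  then show ?case by (cases s) (auto, metis clift.simps(7))
next
  case (Catch t)
  from Catch.prems obtain s' where s: "s = Catch s'" and
    eq: "clift (Suc i) t = clift (Suc (Suc k)) s'"
    by (cases s) auto
  from Catch.IH[OF _ eq] Catch.prems obtain p where "t = clift (Suc k) p" "s' = clift (Suc i) p"
    by auto
  then have "Catch t = clift k (Catch p) \<and> s = clift i (Catch p)" using s by simp
  then show ?case by blast
next
  case (Throw a t)
  from Throw.prems obtain b s' where s: "s = Throw b s'" and
    eq: "clift i t = clift (Suc k) s'" and
    ab: "(if a < i then a else Suc a) = (if b < Suc k then b else Suc b)"
    by (cases s) auto
  from Throw.IH[OF _ eq] Throw.prems obtain p where p: "t = clift k p" "s' = clift i p"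
    by auto
  \<comment> \<open>\<open>c\<close> is the index \<open>a\<close> with the gap at \<open>k\<close>
    closed. By \<open>ab\<close>, \<open>a\<close> differs from \<open>k\<close>, so the second
    branch has \<open>a > k\<close> and the subtraction does not truncate.\<close>
  define c where "c = (if a < k then a else a - 1)"
  have "Throw a t = clift k (Throw c p) \<and> s = clift i (Throw c p)"
    using s p ab Throw.prems(1) by (auto simp: c_def split: if_splits)
  then show ?case by blast
qed (rename_tac s, case_tac s, auto)+

section \<open>Values and answers\<close>

lemma val_not_Throw [simp]: "\<not> val (Throw a t)"
  by (auto elim: val.cases)

lemma val_lift: "val v \<Longrightarrow> val (lift k v)"
  by (induction rule: val.induct) (auto intro: val.intros)

lemma val_clift: "val v \<Longrightarrow> val (clift k v)"
  by (induction rule: val.induct) (auto intro: val.intros)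

lemma val_cliftD: "val (clift k v) \<Longrightarrow> val v"
  by (induction "clift k v" arbitrary: v rule: val.induct) (auto intro: val.intros)

lemma val_subst: "val v \<Longrightarrow> val u \<Longrightarrow> val (subst v k u)"
  by (induction arbitrary: k rule: val.induct) (auto intro: val.intros)

text \<open>Answers are the bodies that a catch releases when its own continuation variable is not
  free in them; the notion merges \<open>catch_throw_other\<close> and \<open>catch_val\<close> into
  one case.\<close>

definition answer :: "trm \<Rightarrow> bool" where
  "answer t \<longleftrightarrow> val t \<or> (\<exists>b v. t = Throw b v \<and> val v)"

lemma answer_lift: "answer t \<Longrightarrow> answer (lift k t)"
  by (auto simp: answer_def val_lift)

lemma answer_clift: "answer t \<Longrightarrow> answer (clift k t)"
  by (auto simp: answer_def val_clift split del: if_split)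

lemma answer_cliftD: "answer (clift k t) \<Longrightarrow> answer t"
  by (auto simp: answer_def dest: val_cliftD)

lemma answer_subst: "answer t \<Longrightarrow> val u \<Longrightarrow> answer (subst t k u)"
  by (auto simp: answer_def val_subst)

text \<open>
  Stating \<open>par_Catch_answer\<close> with \<open>clift 0 t\<close> on the left makes its side condition
  implicit.  The rules dropping a context around a throw reduce the whole \<open>Throw a t\<close>, so that a
  tower of throws can collapse in a single step.
\<close>

inductive par :: "trm \<Rightarrow> trm \<Rightarrow> bool" where
  par_Var: "par (Var i) (Var i)"
| par_UnitC: "par UnitC UnitC"
| par_NilC: "par NilC NilC"
| par_ConsC: "par ConsC ConsC"
| par_LRec: "par LRec LRec"
| par_Lam: "par t t' \<Longrightarrow> par (Lam t) (Lam t')"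
| par_App: "par t t' \<Longrightarrow> par s s' \<Longrightarrow> par (App t s) (App t' s')"
| par_Catch: "par t t' \<Longrightarrow> par (Catch t) (Catch t')"
| par_Throw: "par t t' \<Longrightarrow> par (Throw a t) (Throw a t')"
| par_beta: "par t t' \<Longrightarrow> val v \<Longrightarrow> par v v' \<Longrightarrow> par (App (Lam t) v) (subst t' 0 v')"
| par_AppL_Throw: "par (Throw a t) u \<Longrightarrow> par (App (Throw a t) s) u"
| par_AppR_Throw: "val v \<Longrightarrow> par (Throw a t) u \<Longrightarrow> par (App v (Throw a t)) u"
| par_Throw_Throw: "par (Throw a t) u \<Longrightarrow> par (Throw b (Throw a t)) u"
| par_Catch_Throw: "par t t' \<Longrightarrow> par (Catch (Throw 0 t)) (Catch t')"
| par_Catch_answer: "answer t \<Longrightarrow> par t t' \<Longrightarrow> par (Catch (clift 0 t)) t'"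
| par_lrec_nil: "val vr \<Longrightarrow> val vs \<Longrightarrow> par vr vr' \<Longrightarrow>
    par (App (App (App LRec vr) vs) NilC) vr'"
| par_lrec_cons: "val vr \<Longrightarrow> val vs \<Longrightarrow> val vh \<Longrightarrow> val vt \<Longrightarrow>
    par vr vr' \<Longrightarrow> par vs vs' \<Longrightarrow> par vh vh' \<Longrightarrow> par vt vt' \<Longrightarrow>
    par (App (App (App LRec vr) vs) (App (App ConsC vh) vt))
      (App (App (App vs' vh') vt') (App (App (App LRec vr') vs') vt'))"

section \<open>Inversion and stability of parallel reduction\<close>

inductive_cases par_VarE [elim!]: "par (Var i) u"
inductive_cases par_UnitCE [elim!]: "par UnitC u"
inductive_cases par_NilCE [elim!]: "par NilC u"
inductive_cases par_ConsCE [elim!]: "par ConsC u"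
inductive_cases par_LRecE [elim!]: "par LRec u"
inductive_cases par_LamE [elim!]: "par (Lam t) u"
inductive_cases par_AppE: "par (App t s) u"
inductive_cases par_ThrowE: "par (Throw a t) u"

lemma par_refl [simp]: "par t t"
  by (induction t) (auto intro: par.intros)

lemma par_lift: "par t t' \<Longrightarrow> par (lift k t) (lift k t')"
proof (induction arbitrary: k rule: par.induct)
  case (par_beta t t' v v')
  then show ?case by (simp add: lift_subst_ge par.par_beta val_lift)
next
  case (par_Catch_answer t t')
  then show ?case by (simp add: lift_clift par.par_Catch_answer answer_lift)
qed (auto intro: par.intros simp: val_lift)

lemma par_clift: "par t t' \<Longrightarrow> par (clift k t) (clift k t')"
proof (induction arbitrary: k rule: par.induct)
  case (par_beta t t' v v')
  then show ?case by (simp add: clift_subst par.par_beta val_clift)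
next
  case (par_Catch_answer t t')
  \<comment> \<open>Swapping the liftings puts the one at 0 outermost, which is the form the rule
    asks for.\<close>
  then show ?case by (simp add: clift_clift[symmetric] par.par_Catch_answer answer_clift)
qed (auto intro: par.intros simp: val_clift split del: if_split)

text \<open>Reduction creates no free continuation variables, and lifting reflects it. Hence the
  side condition of a catch redex survives reduction of the body.\<close>

lemma par_cliftD: "par (clift k t) u \<Longrightarrow> \<exists>t'. u = clift k t' \<and> par t t'"
proof (induction "clift k t" u arbitrary: k t rule: par.induct)
  case (par_Catch_answer s s')
  then obtain t1 where t: "t = Catch t1" and eq: "clift 0 s = clift (Suc k) t1" by auto
  \<comment> \<open>The body misses the index of the catch and the lifted outer index at
    once.\<close>
  from clift_eq_cliftD[OF _ eq] obtain p where p: "s = clift k p" "t1 = clift 0 p" by auto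
  with par_Catch_answer obtain t' where "s' = clift k t'" "par p t'" by blast
  moreover have "answer p" using par_Catch_answer p answer_cliftD by blast
  ultimately show ?case using t p by (auto intro: par.par_Catch_answer)
next
  case (par_beta b b' v v')
  then obtain b1 v1 where t: "t = App (Lam b1) v1" "b = clift k b1" "v = clift k v1"
    by auto
  with par_beta obtain b2 v2 where "b' = clift k b2" "par b1 b2" "v' = clift k v2" "par v1 v2"
    by metis
  then show ?case using t par_beta.hyps
    by (auto simp: clift_subst[symmetric] intro: par.par_beta dest: val_cliftD)
next
  case (par_lrec_cons vr vs vh vt vr' vs' vh' vt')
  then obtain r s h t1 where t: "t = App (App (App LRec r) s) (App (App ConsC h) t1)"
     "vr = clift k r" "vs = clift k s" "vh = clift k h" "vt = clift k t1"
    by auto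
  with par_lrec_cons obtain r' s' h' t1' where "vr' = clift k r'" "par r r'"
    "vs' = clift k s'" "par s s'" "vh' = clift k h'" "par h h'" "vt' = clift k t1'" "par t1 t1'"
    by metis
  then show ?case using t par_lrec_cons.hyps val_cliftD
    by (intro exI[of _ "App (App (App s' h') t1') (App (App (App LRec r') s') t1')"])
      (auto intro!: par.par_lrec_cons)
next
  case (par_Lam s s')
  then show ?case by auto (metis par.par_Lam)
next
  case (par_App s s' r r')
  then show ?case by auto (metis par.par_App)
next
  case (par_Catch s s')
  then show ?case by auto (metis par.par_Catch)
next
  case (par_Throw s s' a)
  then obtain b t1 where t: "t = Throw b t1" "s = clift k t1" "a = (if b < k then b else Suc b)"
    by auto
  with par_Throw obtain t2 where "s' = clift k t2" "par t1 t2" by blast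
  then show ?case using t by (intro exI[of _ "Throw b t2"]) (auto intro: par.par_Throw)
next
  case (par_AppL_Throw a s u r)
  then obtain b s1 r1 where t: "t = App (Throw b s1) r1" and "Throw a s = clift k (Throw b s1)"
    by auto
  with par_AppL_Throw show ?case by (metis par.par_AppL_Throw)
next
  case (par_AppR_Throw v a s u)
  then obtain b s1 v1 where t: "t = App v1 (Throw b s1)" "Throw a s = clift k (Throw b s1)"
     "v = clift k v1"
    by auto
  with par_AppR_Throw show ?case by (metis par.par_AppR_Throw val_cliftD)
next
  case (par_Throw_Throw a s u c)
  then obtain b s1 d where t: "t = Throw d (Throw b s1)" "Throw a s = clift k (Throw b s1)"
    by auto
  with par_Throw_Throw show ?case by (metis par.par_Throw_Throw)
next
  case (par_Catch_Throw s s')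
  then obtain s1 where t: "t = Catch (Throw 0 s1)" "s = clift (Suc k) s1"
    by (auto split: if_splits)
  with par_Catch_Throw obtain s2 where "s' = clift (Suc k) s2" "par s1 s2" by blast
  then show ?case using t by (intro exI[of _ "Catch s2"]) (auto intro: par.par_Catch_Throw)
next
  case (par_lrec_nil vr vs vr')
  then obtain r s where t: "t = App (App (App LRec r) s) NilC" "vr = clift k r" "vs = clift k s"
    by auto
  with par_lrec_nil show ?case by (metis par.par_lrec_nil val_cliftD)
qed auto

text \<open>An applied value is a constant with too few arguments to fire, and its arguments are
  values, hence no throws; only congruence rules apply to it.\<close>

lemma par_val: "val v \<Longrightarrow> par v v' \<Longrightarrow> val v'"
  by (induction arbitrary: v' rule: val.induct) (auto elim!: par_AppE intro: val.intros simp del: par_refl)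

lemma par_Throw_val: "par (Throw a v) u \<Longrightarrow> val v \<Longrightarrow> \<exists>v'. u = Throw a v' \<and> par v v'"
  by (auto elim: par_ThrowE)

lemma par_answer: "answer t \<Longrightarrow> par t t' \<Longrightarrow> answer t'"
  by (auto simp: answer_def dest: par_val par_Throw_val)

text \<open>Variables count as values, so the value premises of the redexes survive substitution
  because \<open>u\<close> is a value.\<close>

lemma par_subst: "par t t' \<Longrightarrow> par u u' \<Longrightarrow> val u \<Longrightarrow> par (subst t k u) (subst t' k u')"
proof (induction arbitrary: k u u' rule: par.induct)
  case (par_beta t t' v v')
  \<comment> \<open>The substitution lemma at index 0 exchanges the contracted binder with the outer
    substitution.\<close>
  then show ?case
    by (auto simp: subst_subst[of 0] intro!: par.par_beta par_lift val_lift val_subst)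
next
  case (par_Catch_answer t t')
  \<comment> \<open>Under the catch \<open>u\<close> is lifted as well, so the substituted body is
    again a lifting at 0.\<close>
  then show ?case
    by (auto simp: clift_subst[symmetric] intro!: par.par_Catch_answer answer_subst)
next
  case (par_Lam t t')
  then show ?case by (simp add: par.par_Lam par_lift val_lift)
next
  case (par_Catch t t')
  then show ?case by (simp add: par.par_Catch par_clift val_clift)
next
  case (par_Catch_Throw t t')
  then show ?case by (simp add: par.par_Catch_Throw par_clift val_clift)
next
  case (par_lrec_cons vr vs vh vt vr' vs' vh' vt')
  then show ?case by (simp add: par.par_lrec_cons val_subst)
qed (auto intro: par.intros simp: val_subst)

section \<open>Parallel reduction between one-step and many-step reduction\<close>

lemma contract_par: "contract t t' \<Longrightarrow> par t t'"
proof (induction rule: contract.induct)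
  case (ctx_throw E a t)
  then show ?case by (cases E) (auto intro: par.intros)
next
  case (catch_throw_other v b)
  \<comment> \<open>The side condition says that 0 is not free in \<open>Throw b v\<close>, so
    lowering can be undone and the body has the lifted form of
    \<open>par_Catch_answer\<close>.\<close>
  then have "clift 0 (clower 0 (Throw b v)) = Throw b v" by (intro clift_clower) auto
  moreover have "answer (Throw b v)" using catch_throw_other by (auto simp: answer_def)
  ultimately show ?case by (metis par_Catch_answer answer_cliftD par_refl)
next
  case (catch_val v)
  then have "clift 0 (clower 0 v) = v" by (intro clift_clower)
  moreover have "answer v" using catch_val by (auto simp: answer_def)
  ultimately show ?case by (metis par_Catch_answer answer_cliftD par_refl)
qed (auto intro: par.intros)

lemma step_par: "step t t' \<Longrightarrow> par t t'"
  by (induction rule: step.induct) (auto intro: par.intros contract_par)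

lemma steps_Lam: "steps t t' \<Longrightarrow> steps (Lam t) (Lam t')"
  by (induction rule: rtranclp_induct) (auto intro: rtranclp.rtrancl_into_rtrancl step_Lam)

lemma steps_Catch: "steps t t' \<Longrightarrow> steps (Catch t) (Catch t')"
  by (induction rule: rtranclp_induct) (auto intro: rtranclp.rtrancl_into_rtrancl step_Catch)

lemma steps_Throw: "steps t t' \<Longrightarrow> steps (Throw a t) (Throw a t')"
  by (induction rule: rtranclp_induct) (auto intro: rtranclp.rtrancl_into_rtrancl step_Throw)

lemma steps_App:
  assumes "steps t t'" and "steps s s'"
  shows "steps (App t s) (App t' s')"
proof -
  have "steps (App t s) (App t' s)" using assms(1)
    by (induction rule: rtranclp_induct) (auto intro: rtranclp.rtrancl_into_rtrancl step_AppL)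
  also have "steps (App t' s) (App t' s')" using assms(2)
    by (induction rule: rtranclp_induct) (auto intro: rtranclp.rtrancl_into_rtrancl step_AppR)
  finally show ?thesis .
qed

text \<open>The side condition becomes explicit again: 0 is not free in a lifted term, and lowering
  undoes the lifting.\<close>

lemma contract_Catch_answer:
  assumes "answer t" shows "contract (Catch (clift 0 t)) t"
proof -
  have nf: "0 \<notin> FCV (clift 0 t)" and low: "clower 0 (clift 0 t) = t"
    by (rule not_in_FCV_clift, rule clower_clift)
  from answer_clift[OF assms, of 0] consider "val (clift 0 t)"
    | b v where "clift 0 t = Throw b v" "val v"
    unfolding answer_def by blast
  then show ?thesis
  proof cases
    case 1
    then show ?thesis using catch_val nf low by metis
  next
    case 2
    then show ?thesis using catch_throw_other[of v b] nf low by auto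
  qed
qed

lemma steps_contract: "steps t t' \<Longrightarrow> contract t' u \<Longrightarrow> steps t u"
  by (meson rtranclp.rtrancl_into_rtrancl step_contract)

lemma contract_steps: "contract t t' \<Longrightarrow> steps t' u \<Longrightarrow> steps t u"
  by (meson converse_rtranclp_into_rtranclp step_contract)

lemma par_steps: "par t t' \<Longrightarrow> steps t t'"
proof (induction rule: par.induct)
  case (par_beta t t' v v')
  \<comment> \<open>Here the subterms are reduced before contracting, which avoids closing
    \<open>steps\<close> under substitution; \<open>v'\<close> is still a value. The other redexes
    are contracted first.\<close>
  then have "steps (App (Lam t) v) (App (Lam t') v')" by (intro steps_App steps_Lam)
  then show ?case using par_beta par_val steps_contract contract.beta by metis
next
  case (par_AppL_Throw a t u s)
  then show ?case using contract_steps ctx_throw[of "CtxL s" a t] by simp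
next
  case (par_AppR_Throw v a t u)
  then show ?case using contract_steps ctx_throw[of "CtxR v" a t] by simp
next
  case (par_Throw_Throw a t u b)
  then show ?case using contract_steps ctx_throw[of "CtxThrow b" a t] by simp
next
  case (par_Catch_Throw t t')
  then show ?case using contract_steps catch_throw_same steps_Catch by blast
next
  case (par_Catch_answer t t')
  then show ?case using contract_steps contract_Catch_answer by blast
next
  case (par_lrec_nil vr vs vr')
  then show ?case using contract_steps lrec_nil by blast
next
  case (par_lrec_cons vr vs vh vt vr' vs' vh' vt')
  show ?case
    by (rule contract_steps[OF lrec_cons])
      (use par_lrec_cons in \<open>auto intro!: steps_App\<close>)
qed (auto intro: steps_Lam steps_App steps_Catch steps_Throw)

section \<open>Complete developments\<close>

text \<open>With value arguments no throw can escape, and the recursor still lacks its third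
  argument, so only congruence applies.\<close>

lemma par_lrec:
  assumes "par (App (App LRec v) w) u" "val v" "val w"
  shows "\<exists>v' w'. u = App (App LRec v') w' \<and> par v v' \<and> par w w'"
  using assms by (auto elim!: par_AppE)

lemma par_cons:
  assumes "par (App (App ConsC v) w) u" "val v" "val w"
  shows "\<exists>v' w'. u = App (App ConsC v') w' \<and> par v v' \<and> par w w'"
  using assms by (auto elim!: par_AppE)

text \<open>A tower of throws can collapse only to another throw, so a context around it can still
  be dropped after reduction inside.\<close>

lemma par_Throw_is_Throw: "par (Throw a t) u \<Longrightarrow> \<exists>b s. u = Throw b s"
  by (induction "Throw a t" u arbitrary: a t rule: par.induct) auto

text \<open>Takahashi's complete development, specified by its triangle property as a relation
  instead of a recursive function; the redex patterns are then treated one lemma at a time.\<close>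

definition dev :: "trm \<Rightarrow> trm \<Rightarrow> bool" where
  "dev t u \<longleftrightarrow> (\<forall>t'. par t t' \<longrightarrow> par t' u)"

lemma devI: "(\<And>t'. par t t' \<Longrightarrow> par t' u) \<Longrightarrow> dev t u"
  by (simp add: dev_def)

lemma devD: "dev t u \<Longrightarrow> par t t' \<Longrightarrow> par t' u"
  by (simp add: dev_def)

lemma dev_Lam: "dev t u \<Longrightarrow> dev (Lam t) (Lam u)"
  by (auto intro!: devI par_Lam dest: devD)

lemma dev_Throw_Throw:
  assumes "dev (Throw b t) u"
  shows "dev (Throw a (Throw b t)) u"
proof (rule devI)
  fix t' assume "par (Throw a (Throw b t)) t'"
  then show "par t' u"
  proof cases
    case (par_Throw s)
    then show ?thesis using assms par_Throw_is_Throw par_Throw_Throw devD by blast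
  qed (use assms devD in blast)
qed

lemma dev_Throw: "\<nexists>b s. t = Throw b s \<Longrightarrow> dev t u \<Longrightarrow> dev (Throw a t) (Throw a u)"
  by (rule devI, erule par_ThrowE) (use devD par_Throw in blast)+

lemma dev_Catch_Throw:
  assumes "dev t u"
  shows "dev (Catch (Throw 0 t)) (Catch u)"
proof (rule devI)
  fix t' assume "par (Catch (Throw 0 t)) t'"
  then show "par t' (Catch u)"
  proof cases
    case (par_Catch s)
    from par_Catch(2) show ?thesis
    proof cases
      case (par_Throw r)
      then show ?thesis using assms par_Catch devD par_Catch_Throw by blast
    next
      case (par_Throw_Throw a r)
      \<comment> \<open>Here \<open>t\<close> is itself a throw that has discarded the outer
        \<open>Throw 0\<close>, so the body of the catch is already a reduct of
        \<open>t\<close>.\<close>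
      then show ?thesis using assms par_Catch devD par.par_Catch by blast
    qed
  next
    case (par_Catch_Throw s)
    then show ?thesis using assms devD par_Catch by blast
  next
    case (par_Catch_answer s)
    \<comment> \<open>A term lifted at 0 never throws to 0, so the two catch redexes exclude each
      other.\<close>
    then show ?thesis by simp
  qed
qed

lemma dev_Catch_answer:
  assumes "dev t u" and "answer t"
  shows "dev (Catch (clift 0 t)) u"
proof (rule devI)
  fix t' assume "par (Catch (clift 0 t)) t'"
  then show "par t' u"
  proof cases
    case (par_Catch s)
    \<comment> \<open>Index 0 stays absent from the reduct, so the catch remains a redex.\<close>
    then obtain r where r: "s = clift 0 r" "par t r" using par_cliftD by blast
    then have "answer r" "par r u" using assms par_answer devD by blast+
    then show ?thesis using r par_Catch par_Catch_answer by blast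
  next
    case (par_Catch_Throw s s')
    then show ?thesis by simp
  next
    case (par_Catch_answer s)
    then show ?thesis using assms devD by simp
  qed
qed

lemma dev_Catch:
  assumes "dev t u" and "\<nexists>s. t = Throw 0 s" and "\<nexists>s. t = clift 0 s \<and> answer s"
  shows "dev (Catch t) (Catch u)"
proof (rule devI)
  fix t' assume "par (Catch t) t'"
  then show "par t' (Catch u)"
    by cases (use assms devD par_Catch in blast)+
qed

lemma dev_AppL_Throw:
  assumes "dev (Throw a t) u"
  shows "dev (App (Throw a t) s) u"
proof (rule devI)
  fix t' assume "par (App (Throw a t) s) t'"
  then show "par t' u"
  proof cases
    case (par_App r q)
    then show ?thesis using assms par_Throw_is_Throw par_AppL_Throw devD by blast
  next
    case par_AppL_Throw
    then show ?thesis using assms devD by blast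
  qed simp_all
qed

lemma dev_AppR_Throw:
  assumes "dev (Throw a t) u" and "val v"
  shows "dev (App v (Throw a t)) u"
proof (rule devI)
  fix t' assume "par (App v (Throw a t)) t'"
  then show "par t' u"
  proof cases
    case (par_App r q)
    then obtain b s where "q = Throw b s" using par_Throw_is_Throw by blast
    moreover have "val r" "par q u" using par_App assms par_val devD by blast+
    ultimately show ?thesis using par_App par_AppR_Throw by blast
  qed (use assms devD in auto)
qed

lemma dev_beta:
  assumes "dev t u" and "dev v w" and "val v"
  shows "dev (App (Lam t) v) (subst u 0 w)"
proof (rule devI)
  fix t' assume "par (App (Lam t) v) t'"
  then show "par t' (subst u 0 w)"
  proof cases
    case (par_App r q)
    then obtain t1 where "r = Lam t1" "par t t1" by blast
    moreover have "val q" "par q w" using par_App assms par_val devD by blast+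
    ultimately show ?thesis using par_App assms devD par_beta by blast
  next
    case (par_beta t1 v1)
    \<comment> \<open>The redex is already contracted; the developments of body and argument are
      combined by \<open>par_subst\<close>.\<close>
    then show ?thesis using assms devD par_val par_subst by blast
  qed (use assms in auto)
qed

lemma dev_lrec_nil:
  assumes "dev v u" and "val v" and "val w"
  shows "dev (App (App (App LRec v) w) NilC) u"
proof (rule devI)
  fix t' assume "par (App (App (App LRec v) w) NilC) t'"
  then show "par t' u"
  proof cases
    case (par_App r q)
    then obtain v' w' where "r = App (App LRec v') w'" "par v v'" "par w w'"
      using par_lrec assms by blast
    moreover have "q = NilC" using par_App by blast
    ultimately show ?thesis using par_App assms devD par_val par_lrec_nil by blast
  next
    case (par_lrec_nil)
    then show ?thesis using assms devD by blast
  qed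
qed

lemma dev_lrec_cons:
  assumes dev: "dev vr ur" "dev vs us" "dev vh uh" "dev vt ut"
    and val: "val vr" "val vs" "val vh" "val vt"
  shows "dev (App (App (App LRec vr) vs) (App (App ConsC vh) vt))
    (App (App (App us uh) ut) (App (App (App LRec ur) us) ut))"
proof (rule devI)
  fix t' assume "par (App (App (App LRec vr) vs) (App (App ConsC vh) vt)) t'"
  then show "par t' (App (App (App us uh) ut) (App (App (App LRec ur) us) ut))"
  proof cases
    case (par_App r q)
    obtain vr' vs' where r: "r = App (App LRec vr') vs'" "par vr vr'" "par vs vs'"
      using par_lrec[OF par_App(2)] val by blast
    obtain vh' vt' where q: "q = App (App ConsC vh') vt'" "par vh vh'" "par vt vt'"
      using par_cons[OF par_App(3)] val by blast
    show ?thesis unfolding par_App(1) r(1) q(1)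
      by (rule par_lrec_cons) (use r q dev val devD par_val in blast)+
  next
    case (par_lrec_cons vr' vs' vh' vt')
    show ?thesis unfolding par_lrec_cons(1)
      by (intro par.par_App par.par_LRec) (use par_lrec_cons dev devD in blast)+
  qed
qed

text \<open>The negated premises rule out every redex pattern headed by an application, which leaves
  congruence alone.\<close>

lemma dev_App:
  assumes "dev t u" and "dev s w"
    and "\<nexists>a q. t = Throw a q" and "\<nexists>a q. val t \<and> s = Throw a q" and "\<nexists>b. t = Lam b \<and> val s"
    and "\<nexists>vr vs. t = App (App LRec vr) vs \<and> s = NilC \<and> val vr \<and> val vs"
    and "\<nexists>vr vs vh vt. t = App (App LRec vr) vs \<and> s = App (App ConsC vh) vt \<and>
      val vr \<and> val vs \<and> val vh \<and> val vt"
  shows "dev (App t s) (App u w)"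
proof (rule devI)
  fix t' assume "par (App t s) t'"
  then show "par t' (App u w)"
  proof cases
    case (par_App r q)
    then show ?thesis using assms(1,2) by (auto intro: par.par_App dest: devD)
  qed (use assms(3-) in auto)
qed

text \<open>The induction is on size because the development of \<open>Catch (clift 0 r)\<close>
  uses that of \<open>r\<close>, which need not be a subterm.\<close>

lemma dev_exists: "\<exists>u. dev t u"
proof (induction t rule: measure_induct_rule[where f = size])
  case (less t)
  show ?case
  proof (cases t)
    case (Lam s)
    then show ?thesis using less[of s] dev_Lam by auto
  next
    case (Throw a s)
    moreover obtain u where "dev s u" using Throw less[of s] by auto
    ultimately show ?thesis
      using dev_Throw_Throw dev_Throw by (cases "\<exists>b r. s = Throw b r") blast+
  next
    case t: (Catch s)
    consider r where "s = Throw 0 r" | r where "s = clift 0 r" "answer r"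
      | "\<nexists>r. s = Throw 0 r" "\<nexists>r. s = clift 0 r \<and> answer r" by blast
    then show ?thesis
    proof cases
      case (1 r)
      then obtain u where "dev r u" using t less[of r] by auto
      then show ?thesis using 1 t dev_Catch_Throw by blast
    next
      case (2 r)
      \<comment> \<open>Lifting only renumbers indices, so \<open>r\<close> is smaller than the
        catch around its lifting.\<close>
      have "size (clift k r) = size r" for k by (induction r arbitrary: k) auto
      then obtain u where "dev r u" using 2 t less[of r] by auto
      then show ?thesis using 2 t dev_Catch_answer by blast
    next
      case 3
      moreover obtain u where "dev s u" using t less[of s] by auto
      ultimately show ?thesis using t dev_Catch by blast
    qed
  next
    case t: (App s r)
    \<comment> \<open>When \<open>s\<close> or \<open>r\<close> is a throw, its own development
      serves for the whole application.\<close>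
    then obtain su ru where su: "dev s su" and ru: "dev r ru" using less[of s] less[of r] by auto
    consider a q where "s = Throw a q" | a q where "val s" "r = Throw a q"
      | b where "s = Lam b" "val r"
      | v w where "s = App (App LRec v) w" "r = NilC" "val v" "val w"
      | v w h l where "s = App (App LRec v) w" "r = App (App ConsC h) l"
         "val v" "val w" "val h" "val l"
      | "\<nexists>a q. s = Throw a q" "\<nexists>a q. val s \<and> r = Throw a q" "\<nexists>b. s = Lam b \<and> val r"
        "\<nexists>v w. s = App (App LRec v) w \<and> r = NilC \<and> val v \<and> val w"
        "\<nexists>v w h l. s = App (App LRec v) w \<and> r = App (App ConsC h) l \<and>
         val v \<and> val w \<and> val h \<and> val l"
      by blast
    then show ?thesis
    proof cases
      case 1
      then show ?thesis using t su dev_AppL_Throw by blast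
    next
      case 2
      then show ?thesis using t ru dev_AppR_Throw by blast
    next
      case (3 b)
      then obtain bu where "dev b bu" using t less[of b] by auto
      then show ?thesis using 3 t ru dev_beta by blast
    next
      case (4 v w)
      then obtain vu where "dev v vu" using t less[of v] by auto
      then show ?thesis using 4 t dev_lrec_nil by blast
    next
      case (5 v w h l)
      then obtain vu wu hu lu where "dev v vu" "dev w wu" "dev h hu" "dev l lu"
        using t less[of v] less[of w] less[of h] less[of l] by auto
      then show ?thesis using 5 t dev_lrec_cons by blast
    next
      case 6
      then show ?thesis using t su ru dev_App by blast
    qed
  qed (rule exI[of _ t], auto simp: dev_def)+
qed

section \<open>From the diamond property to confluence\<close>

lemma par_diamond: "par t t1 \<Longrightarrow> par t t2 \<Longrightarrow> \<exists>u. par t1 u \<and> par t2 u"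
  using dev_exists devD by blast

text \<open>The strip lemma: diamonds are laid side by side along the reduction from
  \<open>t\<close> to \<open>t1\<close>.\<close>

lemma par_strip: "par\<^sup>*\<^sup>* t t1 \<Longrightarrow> par t t2 \<Longrightarrow> \<exists>u. par t1 u \<and> par\<^sup>*\<^sup>* t2 u"
  by (induction rule: rtranclp_induct) (auto, meson par_diamond rtranclp.rtrancl_into_rtrancl)

lemma par_confluent: "par\<^sup>*\<^sup>* t t1 \<Longrightarrow> par\<^sup>*\<^sup>* t t2 \<Longrightarrow> \<exists>u. par\<^sup>*\<^sup>* t1 u \<and> par\<^sup>*\<^sup>* t2 u"
proof (induction arbitrary: t2 rule: converse_rtranclp_induct)
  case (step t s)
  \<comment> \<open>The first step is pushed across the whole reduction to \<open>t2\<close>; the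
    induction hypothesis then joins the two reductions out of \<open>s\<close>.\<close>
  from par_strip[OF step.prems step.hyps(1)] obtain r where r: "par t2 r" "par\<^sup>*\<^sup>* s r" by blast
  from step.IH[OF r(2)] obtain u where "par\<^sup>*\<^sup>* t1 u" "par\<^sup>*\<^sup>* r u" by blast
  then show ?case using r(1) by (meson converse_rtranclp_into_rtranclp)
qed blast

lemma par_rtranclp_eq: "par\<^sup>*\<^sup>* = steps"
proof (intro antisym predicate2I)
  show "steps t u" if "par\<^sup>*\<^sup>* t u" for t u
    using that by (induction rule: rtranclp_induct) (auto dest: par_steps)
  show "par\<^sup>*\<^sup>* t u" if "steps t u" for t u
    using that by (rule mono_rtranclp[rule_format, rotated]) (rule step_par)
qed

theorem theorem3p10:
  fixes t1 t2 t3 :: trm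
  assumes "steps t1 t2" and "steps t1 t3"
  shows "\<exists>t4. steps t2 t4 \<and> steps t3 t4"
  using par_confluent[of t1 t2 t3] assms unfolding par_rtranclp_eq by blast

end
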